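(* Let $(X,d)$ be a metric space, $n>0$ an integer and $\ell>0$ a real number. Then the following hold. (1) $H_{n}^{\mathrm{simp},\ell}(X)\simeq\bigoplus_{F\in P_{\leq n}^{\ell}(X)}H_{n}^{F}(X)$. (2) If $n=1$, then $H_{1}^{\Sigma,\ell}(X)\simeq\bigoplus_{F\in P_{1}^{\ell}(X)}H_{1}^{F}(X)$. (3) If $\ell<m_X$, then $H_{n}^{\Sigma,\ell}(X)\simeq\bigoplus_{F\in P_{\leq n}^{\ell}(X)}H_{n}^{F}(X)$.
   Context: Let $(X,d)$ be a metric space. For $x,y,z\in X$ write $x\preceq y\preceq z$ if $d(x,y)+d(y,z)=d(x,z)$, and $x\prec y\prec z$ if moreover $x\neq y$ and $y\neq z$. A tuple $\boldsymbol{x}=(x_0,\dots,x_n)\in X^{n+1}$ is a proper chain of degree $n$ if $x_{i-1}\neq x_i$ for all $i=1,\dots,n$; its length is $|\boldsymbol{x}|=\sum_{i=1}^n d(x_{i-1},x_i)$. $P_n(X)$ is the set of proper chains of degree $n$, and $P_n^{\ell}(X)$ is the set of those of length $\ell$. $P_{\le n}^{\ell}(X)=P_1^{\ell}(X)\sqcup\cdots\sqcup P_n^{\ell}(X)$. A $4$-cut of $X$ is $(x_0,x_1,x_2,x_3)\in P_3(X)$ with $x_0\prec x_1\prec x_2$, $x_1\prec x_2\prec x_3$ and $d(x_0,x_3)<|(x_0,x_1,x_2,x_3)|$. $m_X$ is the infimum of the lengths of all $4$-cuts of $X$, with $m_X=+\infty$ if there are none. The magnitude chain complex in grading $\ell$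 is $B_n^{\ell}(X)=\bigoplus_{\boldsymbol{x}\in P_n^{\ell}(X)}\mathbb{Z}\cdot\langle\boldsymbol{x}\rangle$ with boundary $\partial_n=\sum_i(-1)^i\partial_{n,i}$, where $\partial_{n,i}\langle x_0,\dots,x_n\rangle=\langle x_0,\dots,\widehat{x_i},\dots,x_n\rangle$ if $1\le i\le n-1$ and $x_{i-1}\prec x_i\prec x_{i+1}$, and $\partial_{n,i}\langle x_0,\dots,x_n\rangle=0$ otherwise. Its homology is the magnitude homology $H_n^{\Sigma,\ell}(X)$. For $\boldsymbol{x}=(x_0,\dots,x_n)\in P_n(X)$, the point $x_i$ is a smooth point of $\boldsymbol{x}$ if $1\le i\le n-1$ and $x_{i-1}\prec x_i\prec x_{i+1}$, and a singular point otherwise. The frame $\varphi(\boldsymbol{x})$ is the tuple of all singular points $(x_{i_1},\dots,x_{i_m})$ in order, where $i_1=0<\cdots<i_m=n$. The chain $\boldsymbol{x}$ is geodesically simple if $|\varphi(\boldsymbol{x})|=|\boldsymbol{x}|$. $B_n^{\mathrm{simp},\ell}(X)\subset B_n^{\ell}(X)$ is the submodule generated by geodesically simple chains of degree $n$ and length $\ell$. For $F\in P_m(X)$, set $P_n^F(X)=\{\boldsymbol{x}\in P_n^{|F|}(X)\mid\varphi(\boldsymbol{x})=F\}$ and $B_n^F(X)=\bigoplus_{\boldsymbol{x}\in P_n^F(X)}\mathbb{Z}\cdot\langle\boldsymbol{x}\rangle$ (which is $0$ if $P_n^F(X)=\emptyset$). These are subcomplexes of $B_\bullet^{\ell}(X)$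 (with $\ell=|F|$ in the second case), and $H_n^{\mathrm{simp},\ell}(X):=H_n(B_\bullet^{\mathrm{simp},\ell}(X))$, $H_n^F(X):=H_n(B_\bullet^F(X))$. *)

theory Defs
  imports
    "HOL-Analysis.Abstract_Metric_Spaces"
    "HOL-Algebra.Free_Abelian_Groups"
    "HOL-Algebra.Product_Groups"
    "HOL-Library.Extended_Real"
begin

text \<open>
  A metric space is given by a carrier \<open>M\<close> and a distance \<open>d\<close> with \<open>Metric_space M d\<close>.
  A tuple \<open>(x\<^sub>0, \<dots>, x\<^sub>n)\<close> is the list of its \<open>n + 1\<close> entries, so \<open>xs ! i\<close> is \<open>x\<^sub>i\<close>.
\<close>

definition strictly_between :: "('a \<Rightarrow> 'a \<Rightarrow> real) \<Rightarrow> 'a \<Rightarrow> 'a \<Rightarrow> 'a \<Rightarrow> bool" where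
  "strictly_between d x y z \<longleftrightarrow> d x y + d y z = d x z \<and> x \<noteq> y \<and> y \<noteq> z"

definition proper_chains :: "'a set \<Rightarrow> nat \<Rightarrow> 'a list set" where
  "proper_chains M n =
     {xs. length xs = n + 1 \<and> set xs \<subseteq> M \<and> (\<forall>i\<in>{1..n}. xs ! (i - 1) \<noteq> xs ! i)}"

definition chain_length :: "('a \<Rightarrow> 'a \<Rightarrow> real) \<Rightarrow> 'a list \<Rightarrow> real" where
  "chain_length d xs = (\<Sum>i=1..length xs - 1. d (xs ! (i - 1)) (xs ! i))"

definition proper_chains_len :: "'a set \<Rightarrow> ('a \<Rightarrow> 'a \<Rightarrow> real) \<Rightarrow> real \<Rightarrow> nat \<Rightarrow> 'a list set" where
  "proper_chains_len M d l n = {xs \<in> proper_chains M n. chain_length d xs = l}"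

definition proper_chains_upto :: "'a set \<Rightarrow> ('a \<Rightarrow> 'a \<Rightarrow> real) \<Rightarrow> real \<Rightarrow> nat \<Rightarrow> 'a list set" where
  "proper_chains_upto M d l n = (\<Union>m\<in>{1..n}. proper_chains_len M d l m)"

definition four_cuts :: "'a set \<Rightarrow> ('a \<Rightarrow> 'a \<Rightarrow> real) \<Rightarrow> 'a list set" where
  "four_cuts M d =
     {xs \<in> proper_chains M 3.
        strictly_between d (xs ! 0) (xs ! 1) (xs ! 2) \<and>
        strictly_between d (xs ! 1) (xs ! 2) (xs ! 3) \<and>
        d (xs ! 0) (xs ! 3) < chain_length d xs}"

text \<open>The infimum is taken in \<^typ>\<open>ereal\<close>, so it is \<open>\<infinity>\<close> if there are no 4-cuts.\<close>

definition min_four_cut :: "'a set \<Rightarrow> ('a \<Rightarrow> 'a \<Rightarrow> real) \<Rightarrow> ereal" where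
  "min_four_cut M d = (INF xs\<in>four_cuts M d. ereal (chain_length d xs))"

definition smooth_at :: "('a \<Rightarrow> 'a \<Rightarrow> real) \<Rightarrow> 'a list \<Rightarrow> nat \<Rightarrow> bool" where
  "smooth_at d xs i \<longleftrightarrow>
     1 \<le> i \<and> i + 1 < length xs \<and> strictly_between d (xs ! (i - 1)) (xs ! i) (xs ! (i + 1))"

definition frame :: "('a \<Rightarrow> 'a \<Rightarrow> real) \<Rightarrow> 'a list \<Rightarrow> 'a list" where
  "frame d xs = nths xs {i. i < length xs \<and> \<not> smooth_at d xs i}"

definition geod_simple :: "('a \<Rightarrow> 'a \<Rightarrow> real) \<Rightarrow> 'a list \<Rightarrow> bool" where
  "geod_simple d xs \<longleftrightarrow> chain_length d (frame d xs) = chain_length d xs"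

definition simple_chains :: "'a set \<Rightarrow> ('a \<Rightarrow> 'a \<Rightarrow> real) \<Rightarrow> real \<Rightarrow> nat \<Rightarrow> 'a list set" where
  "simple_chains M d l n = {xs \<in> proper_chains_len M d l n. geod_simple d xs}"

definition frame_chains :: "'a set \<Rightarrow> ('a \<Rightarrow> 'a \<Rightarrow> real) \<Rightarrow> 'a list \<Rightarrow> nat \<Rightarrow> 'a list set" where
  "frame_chains M d F n = {xs \<in> proper_chains_len M d (chain_length d F) n. frame d xs = F}"

text \<open>
  The free abelian group on a set \<open>S\<close> of chains is \<^term>\<open>free_Abelian_group S\<close>; its underlying
  operation is the addition of \<^typ>\<open>'a list \<Rightarrow>\<^sub>0 int\<close>.
\<close>

definition face_map :: "('a \<Rightarrow> 'a \<Rightarrow> real) \<Rightarrow> nat \<Rightarrow> 'a list \<Rightarrow> ('a list \<Rightarrow>\<^sub>0 int)" where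
  "face_map d i xs = (if smooth_at d xs i then frag_of (take i xs @ drop (i + 1) xs) else 0)"

definition boundary :: "('a \<Rightarrow> 'a \<Rightarrow> real) \<Rightarrow> nat \<Rightarrow> ('a list \<Rightarrow>\<^sub>0 int) \<Rightarrow> ('a list \<Rightarrow>\<^sub>0 int)" where
  "boundary d n = frag_extend (\<lambda>xs. \<Sum>i=0..n. frag_cmul ((-1) ^ i) (face_map d i xs))"

text \<open>
  Degree \<open>n\<close> homology, cycles modulo boundaries, of the complex whose degree \<open>k\<close> part is free
  abelian on \<open>C k\<close>. It is used only for families \<open>C\<close> of proper chains spanning a complex that
  is closed under \<^const>\<open>boundary\<close>.
\<close>

definition chain_homology ::
  "('a \<Rightarrow> 'a \<Rightarrow> real) \<Rightarrow> (nat \<Rightarrow> 'a list set) \<Rightarrow> nat \<Rightarrow> ('a list \<Rightarrow>\<^sub>0 int) set monoid" where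
  "chain_homology d C n =
     subgroup_generated (free_Abelian_group (C n))
       {c \<in> carrier (free_Abelian_group (C n)). boundary d n c = 0}
     Mod (boundary d (n + 1) ` carrier (free_Abelian_group (C (n + 1))))"

definition magnitude_homology ::
  "'a set \<Rightarrow> ('a \<Rightarrow> 'a \<Rightarrow> real) \<Rightarrow> real \<Rightarrow> nat \<Rightarrow> ('a list \<Rightarrow>\<^sub>0 int) set monoid" where
  "magnitude_homology M d l n = chain_homology d (proper_chains_len M d l) n"

definition simple_homology ::
  "'a set \<Rightarrow> ('a \<Rightarrow> 'a \<Rightarrow> real) \<Rightarrow> real \<Rightarrow> nat \<Rightarrow> ('a list \<Rightarrow>\<^sub>0 int) set monoid" where
  "simple_homology M d l n = chain_homology d (simple_chains M d l) n"

definition frame_homology ::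
  "'a set \<Rightarrow> ('a \<Rightarrow> 'a \<Rightarrow> real) \<Rightarrow> 'a list \<Rightarrow> nat \<Rightarrow> ('a list \<Rightarrow>\<^sub>0 int) set monoid" where
  "frame_homology M d F n = chain_homology d (frame_chains M d F) n"

end

theory Submission
  imports Defs "HOL-Library.Sublist"
begin

text \<open>
  In a geodesically simple chain the points between two consecutive singular points lie on a
  geodesic. Hence deleting a smooth point keeps the other smooth points smooth and the other singular
  points singular, so the boundary preserves the frame and the simple complex is the direct sum of the
  complexes of the individual frames; sorting a cycle by frames induces the isomorphism in homology.
  A frame of degree \<open>n + 1\<close> does not matter in degree \<open>n\<close>: a chain of degree \<open>n + 1\<close> with
  such a frame has no smooth point and so has zero boundary.

  Every chain of degree at most 2 is simple. Below \<open>m\<^sub>X\<close> the tuple around two consecutive smooth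
  points is never a 4-cut, and deleting smooth points one by one then shows that every chain is simple.
\<close>

section \<open>Deleting smooth points\<close>

definition omit :: "nat \<Rightarrow> 'a list \<Rightarrow> 'a list" where
  "omit i xs = take i xs @ drop (Suc i) xs"

text \<open>
  The 4-tuples around two consecutive smooth points are not 4-cuts.
\<close>

definition cut_free :: "('a \<Rightarrow> 'a \<Rightarrow> real) \<Rightarrow> 'a list \<Rightarrow> bool" where
  "cut_free d xs \<longleftrightarrow>
     (\<forall>i. smooth_at d xs i \<and> smooth_at d xs (Suc i) \<longrightarrow>
        d (xs ! (i - 1)) (xs ! (i + 2))
          = d (xs ! (i - 1)) (xs ! i) + d (xs ! i) (xs ! (i + 1)) + d (xs ! (i + 1)) (xs ! (i + 2)))"

lemma length_omit: "i < length xs \<Longrightarrow> length (omit i xs) = length xs - 1"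
  by (auto simp: omit_def)

lemma nth_omit:
  "\<lbrakk>i < length xs; j + 1 < length xs\<rbrakk> \<Longrightarrow> omit i xs ! j = (if j < i then xs ! j else xs ! Suc j)"
  by (auto simp: omit_def nth_append)

lemma omit_append: "omit (length as) (as @ b # cs) = as @ cs"
  by (simp add: omit_def)

text \<open>The simplicial face identity; it pairs the terms that cancel in
  \<open>boundary_boundary_simple\<close>.\<close>

lemma omit_omit:
  assumes "j < i" "i < length xs"
  shows "omit j (omit i xs) = omit (i - 1) (omit j xs)"
proof (rule nth_equalityI)
  show "length (omit j (omit i xs)) = length (omit (i - 1) (omit j xs))"
    using assms by (auto simp: length_omit)
  fix k assume "k < length (omit j (omit i xs))"
  then have "k + 2 < length xs"
    using assms by (auto simp: length_omit)
  then show "omit j (omit i xs) ! k = omit (i - 1) (omit j xs) ! k"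
    using assms by (auto simp: length_omit nth_omit)
qed

lemma set_omit: "set (omit i xs) \<subseteq> set xs"
  by (auto simp: omit_def dest: in_set_takeD in_set_dropD)

lemma nths_cong:
  assumes "\<And>i. i < length xs \<Longrightarrow> i \<in> A \<longleftrightarrow> i \<in> B"
  shows "nths xs A = nths xs B"
  unfolding nths_def using assms by (intro arg_cong[where f = "map fst"] filter_cong) (auto dest: set_zip_rightD)

text \<open>The index set on the right is the preimage of \<open>A\<close> under the increasing map
  that skips \<open>i\<close>. It turns the selection defining the frame of a chain into a selection
  from the shortened chain.\<close>

lemma nths_omit:
  assumes "i < length xs" "i \<notin> A"
  shows "nths xs A = nths (omit i xs) {j. (if j < i then j else Suc j) \<in> A}"
proof -
  have "nths xs A = nths (take i xs @ xs ! i # drop (Suc i) xs) A"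
    using assms(1) by (simp flip: id_take_nth_drop)
  also have "\<dots> = nths (take i xs) A @ nths (drop (Suc i) xs) {j. Suc (j + i) \<in> A}"
    using assms by (simp add: nths_append nths_Cons min_def)
  also have "nths (take i xs) A = nths (take i xs) {j. (if j < i then j else Suc j) \<in> A}"
    using assms(1) by (intro nths_cong) auto
  finally show ?thesis
    using assms(1) by (simp add: omit_def nths_append min_def)
qed

section \<open>Lengths and smooth points of concatenated chains\<close>

lemma chain_length_Nil [simp]: "chain_length d [] = 0"
  and chain_length_single [simp]: "chain_length d [x] = 0"
  by (simp_all add: chain_length_def)

lemma chain_length_Cons [simp]: "chain_length d (x # y # zs) = d x y + chain_length d (y # zs)"
proof -
  define f where "f i = d ((x # y # zs) ! (i - 1)) ((x # y # zs) ! i)" for i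
  have "chain_length d (x # y # zs) = sum f {Suc 0..Suc (length zs)}"
    by (simp add: chain_length_def f_def)
  also have "\<dots> = f (Suc 0) + sum f {Suc (Suc 0)..Suc (length zs)}"
    by (rule sum.atLeast_Suc_atMost) simp
  also have "sum f {Suc (Suc 0)..Suc (length zs)} = (\<Sum>i=Suc 0..length zs. f (Suc i))"
    by (rule sum.shift_bounds_cl_Suc_ivl)
  also have "\<dots> = chain_length d (y # zs)"
    unfolding chain_length_def by (intro sum.cong) (auto simp: f_def nth_Cons')
  finally show ?thesis
    by (simp add: f_def)
qed

lemma chain_length_append:
  "chain_length d (as @ p # cs) = chain_length d (as @ [p]) + chain_length d (p # cs)"
proof (induction as)
  case (Cons a as)
  then show ?case by (cases as) auto
qed auto

lemma smooth_at_append: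
  "smooth_at d (as @ p # b # q # cs) (Suc (length as)) \<longleftrightarrow> strictly_between d p b q"
  by (simp add: smooth_at_def nth_append)

text \<open>Writing the chain as a concatenation around the smooth point replaces index arithmetic
  by \<open>chain_length_append\<close>.\<close>

lemma smooth_at_split:
  assumes "smooth_at d xs i"
  obtains as p b q cs where "xs = as @ p # b # q # cs" "i = Suc (length as)" "strictly_between d p b q"
proof -
  have i: "1 \<le> i" "i + 1 < length xs"
    using assms by (auto simp: smooth_at_def)
  have "xs = take (i - 1) xs @ drop (i - 1) xs"
    by simp
  also have "drop (i - 1) xs = xs ! (i - 1) # xs ! i # xs ! (i + 1) # drop (i + 2) xs"
    using i Cons_nth_drop_Suc[of "i - 1" xs] Cons_nth_drop_Suc[of i xs] Cons_nth_drop_Suc[of "i + 1" xs]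
    by simp
  finally show thesis
    using that[of "take (i - 1) xs" "xs ! (i - 1)" "xs ! i" "xs ! (i + 1)" "drop (i + 2) xs"] i assms
    by (auto simp: smooth_at_def)
qed

lemma chain_length_omit:
  assumes "smooth_at d xs i"
  shows "chain_length d (omit i xs) = chain_length d xs"
proof -
  obtain as p b q cs where xs: "xs = as @ p # b # q # cs" "i = Suc (length as)" "strictly_between d p b q"
    using assms by (rule smooth_at_split)
  have "omit i xs = as @ p # q # cs"
    using omit_append[of "as @ [p]" b "q # cs"] xs by simp
  then show ?thesis
    using xs chain_length_append[of d as p "q # cs"] chain_length_append[of d as p "b # q # cs"]
    by (simp add: strictly_between_def)
qed

lemma frame_no_smooth: "(\<And>i. \<not> smooth_at d xs i) \<Longrightarrow> frame d xs = xs"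
  by (simp add: frame_def nths_all)

section \<open>Consequences of the triangle inequality\<close>

context Metric_space
begin

lemma chain_length_nonneg: "0 \<le> chain_length d xs"
  by (simp add: chain_length_def sum_nonneg)

text \<open>The common first point \<open>a\<close> makes the induction work: if the head
  \<open>y\<close> of the longer list is skipped, the step from \<open>a\<close> to the first point
  of \<open>xs\<close> is compared with the detour through \<open>y\<close>.\<close>

lemma chain_length_Cons_mono:
  assumes "subseq xs ys" "set ys \<subseteq> M" "a \<in> M"
  shows "chain_length d (a # xs) \<le> chain_length d (a # ys)"
  using assms
proof (induction arbitrary: a rule: list_emb.induct)
  case (list_emb_Cons xs ys y)
  show ?case
  proof (cases xs)
    case Nil
    then show ?thesis by (simp add: chain_length_nonneg)
  next
    case (Cons x xs')
    then have x: "x \<in> M"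
      using list_emb_set[OF list_emb_Cons(1), of x] list_emb_Cons.prems by auto
    have "chain_length d (y # xs) \<le> chain_length d (y # ys)"
      using list_emb_Cons by simp
    moreover have "d a x \<le> d a y + d y x"
      using list_emb_Cons x by (intro triangle) auto
    ultimately show ?thesis
      using Cons by simp
  qed
next
  case (list_emb_Cons2 x y xs ys)
  then show ?case by simp
qed (simp add: chain_length_nonneg)

lemma chain_length_mono:
  assumes "subseq xs ys" "set ys \<subseteq> M"
  shows "chain_length d xs \<le> chain_length d ys"
  using assms
proof (induction rule: list_emb.induct)
  case (list_emb_Cons xs ys y)
  then have "chain_length d ys \<le> chain_length d (y # ys)"
    by (cases ys) auto
  with list_emb_Cons show ?case by simp
next
  case (list_emb_Cons2 x y xs ys)
  then show ?case using chain_length_Cons_mono[of xs ys y] by simp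
qed (simp add: chain_length_nonneg)

text \<open>Only the triples around the two neighbours of the deleted point change. There
  \<open>cut_free\<close> keeps a smooth neighbour smooth, and the triangle inequality keeps a
  singular one singular.\<close>

lemma smooth_at_omit:
  assumes "cut_free d xs" "set xs \<subseteq> M" and i: "smooth_at d xs i"
  shows "smooth_at d (omit i xs) j \<longleftrightarrow> smooth_at d xs (if j < i then j else Suc j)"
proof -
  have len: "i < length xs" "length (omit i xs) = length xs - 1" "0 < i"
    using i by (auto simp: smooth_at_def length_omit)
  consider "Suc j = i" | "j = i" | "Suc j < i" | "i < j" by linarith
  then show ?thesis
  proof cases
    \<comment> \<open>Left neighbour of the deleted point: its successor becomes
      \<open>xs ! (j + 2)\<close>.\<close>
    case 1
    show ?thesis
    proof (cases "1 \<le> j")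
      case True
      have in_M: "xs ! (j - 1) \<in> M" "xs ! j \<in> M" "xs ! Suc j \<in> M" "xs ! (j + 2) \<in> M"
        using assms(2) i 1 by (auto simp: smooth_at_def)
      have e: "d (xs ! j) (xs ! Suc j) + d (xs ! Suc j) (xs ! (j + 2)) = d (xs ! j) (xs ! (j + 2))"
        "xs ! j \<noteq> xs ! Suc j" "xs ! Suc j \<noteq> xs ! (j + 2)"
        using i 1 by (auto simp: smooth_at_def strictly_between_def)
      \<comment> \<open>Otherwise two nonnegative distances would add up to \<open>0\<close>,
        forcing \<open>xs ! j\<close> and \<open>xs ! Suc j\<close> to coincide.\<close>
      then have "xs ! j \<noteq> xs ! (j + 2)"
        using in_M by (metis add_nonneg_eq_0_iff nonneg zero)
      moreover have "smooth_at d (omit i xs) j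
          \<longleftrightarrow> strictly_between d (xs ! (j - 1)) (xs ! j) (xs ! (j + 2))"
        using 1 True len i by (auto simp: smooth_at_def nth_omit)
      moreover have "smooth_at d xs j
          \<longleftrightarrow> strictly_between d (xs ! (j - 1)) (xs ! j) (xs ! Suc j)"
        using 1 True len i by (auto simp: smooth_at_def)
      moreover have "d (xs ! (j - 1)) (xs ! (j + 2)) = d (xs ! (j - 1)) (xs ! j)
           + d (xs ! j) (xs ! Suc j) + d (xs ! Suc j) (xs ! (j + 2))" if "smooth_at d xs j"
        using that assms(1) i 1 unfolding cut_free_def by auto
      moreover have "d (xs ! (j - 1)) (xs ! (j + 2)) \<le> d (xs ! (j - 1)) (xs ! Suc j) + d (xs ! Suc j) (xs ! (j + 2))"
        "d (xs ! (j - 1)) (xs ! Suc j) \<le> d (xs ! (j - 1)) (xs ! j) + d (xs ! j) (xs ! Suc j)"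
        using in_M by (auto intro: triangle)
      ultimately show ?thesis
        using e 1 unfolding strictly_between_def by auto
    qed (use 1 in \<open>auto simp: smooth_at_def\<close>)
  next
    \<comment> \<open>Right neighbour, which moves to index \<open>i\<close>: its predecessor
      becomes \<open>xs ! (j - 1)\<close>.\<close>
    case 2
    show ?thesis
    proof (cases "j + 2 < length xs")
      case True
      have in_M: "xs ! (j - 1) \<in> M" "xs ! j \<in> M" "xs ! Suc j \<in> M" "xs ! (j + 2) \<in> M"
        using assms(2) i 2 True by (auto simp: smooth_at_def)
      have e: "d (xs ! (j - 1)) (xs ! j) + d (xs ! j) (xs ! Suc j) = d (xs ! (j - 1)) (xs ! Suc j)"
        "xs ! (j - 1) \<noteq> xs ! j" "xs ! j \<noteq> xs ! Suc j"
        using i 2 by (auto simp: smooth_at_def strictly_between_def)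
      then have "xs ! (j - 1) \<noteq> xs ! Suc j"
        using in_M by (metis add_nonneg_eq_0_iff nonneg zero)
      moreover have "smooth_at d (omit i xs) j
          \<longleftrightarrow> strictly_between d (xs ! (j - 1)) (xs ! Suc j) (xs ! (j + 2))"
        using 2 True len i by (auto simp: smooth_at_def nth_omit)
      moreover have "smooth_at d xs (Suc j)
          \<longleftrightarrow> strictly_between d (xs ! j) (xs ! Suc j) (xs ! (j + 2))"
        using 2 True len i by (auto simp: smooth_at_def)
      moreover have "d (xs ! (j - 1)) (xs ! (j + 2)) = d (xs ! (j - 1)) (xs ! j)
           + d (xs ! j) (xs ! Suc j) + d (xs ! Suc j) (xs ! (j + 2))" if "smooth_at d xs (Suc j)"
        using that assms(1) i 2 unfolding cut_free_def by auto
      moreover have "d (xs ! (j - 1)) (xs ! (j + 2)) \<le> d (xs ! (j - 1)) (xs ! j) + d (xs ! j) (xs ! (j + 2))"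
        "d (xs ! j) (xs ! (j + 2)) \<le> d (xs ! j) (xs ! Suc j) + d (xs ! Suc j) (xs ! (j + 2))"
        using in_M by (auto intro: triangle)
      ultimately show ?thesis
        using e 2 unfolding strictly_between_def by auto
    qed (use 2 len in \<open>auto simp: smooth_at_def\<close>)
  next
    case 3
    then show ?thesis
      using len i by (auto simp: smooth_at_def nth_omit split: if_splits)
  next
    case 4
    then obtain k where k: "j = Suc k" "i \<le> k"
      by (cases j) auto
    then show ?thesis
      using len i 4 by (auto simp: smooth_at_def nth_omit)
  qed
qed

lemma frame_omit:
  assumes "cut_free d xs" "set xs \<subseteq> M" "smooth_at d xs i"
  shows "frame d (omit i xs) = frame d xs"
proof -
  have i: "i < length xs"
    using assms(3) by (simp add: smooth_at_def)
  have "frame d xs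
      = nths (omit i xs) {j. (if j < i then j else Suc j) \<in> {i. i < length xs \<and> \<not> smooth_at d xs i}}"
    unfolding frame_def using i assms(3) by (intro nths_omit) auto
  also have "\<dots> = frame d (omit i xs)"
    unfolding frame_def using i
    by (intro nths_cong) (auto simp: length_omit smooth_at_omit[OF assms])
  finally show ?thesis ..
qed

text \<open>
  The frame is a subsequence of the chain with two consecutive smooth points deleted, so
  simplicity makes the triangle inequality for that deletion an equality.
\<close>

lemma simple_imp_cut_free:
  assumes "geod_simple d xs" "set xs \<subseteq> M"
  shows "cut_free d xs"
  unfolding cut_free_def
proof (intro allI impI)
  fix i assume i: "smooth_at d xs i \<and> smooth_at d xs (Suc i)"
  then obtain as p b c cs' where xs': "xs = as @ p # b # c # cs'" "i = Suc (length as)"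
    using smooth_at_split by metis
  with i obtain q cs where xs: "xs = as @ p # b # c # q # cs"
    by (cases cs') (auto simp: smooth_at_def)
  let ?A = "{i. i < length xs \<and> \<not> smooth_at d xs i}"
  have "frame d xs = nths (omit i xs) {j. (if j < i then j else Suc j) \<in> ?A}" (is "_ = nths _ ?B")
    unfolding frame_def using i by (intro nths_omit) (auto simp: smooth_at_def)
  also have "omit i xs = as @ p # c # q # cs"
    using omit_append[of "as @ [p]" b "c # q # cs"] xs xs' by simp
  \<comment> \<open>With \<open>b\<close> gone, the other smooth point \<open>c\<close> has moved to
    index \<open>i\<close>, so the same index is deleted again.\<close>
  also have "nths \<dots> ?B = nths (omit i (as @ p # c # q # cs)) {j. (if j < i then j else Suc j) \<in> ?B}"
    using i xs' xs by (intro nths_omit) auto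
  also have "omit i (as @ p # c # q # cs) = as @ p # q # cs"
    using omit_append[of "as @ [p]" c "q # cs"] xs' by simp
  finally have "subseq (frame d xs) (as @ p # q # cs)"
    unfolding subseq_conv_nths by blast
  moreover have "set (as @ p # q # cs) \<subseteq> M"
    using assms(2) xs by auto
  \<comment> \<open>By simplicity the left side is also the length of the frame. Cancelling the
    common parts before \<open>p\<close> and after \<open>q\<close> then bounds three edges by
    \<open>d p q\<close>.\<close>
  ultimately have "chain_length d xs \<le> chain_length d (as @ p # q # cs)"
    using chain_length_mono[of "frame d xs" "as @ p # q # cs"] assms(1) by (simp add: geod_simple_def)
  then have "d p b + d b c + d c q \<le> d p q"
    using xs chain_length_append[of d as p "q # cs"] chain_length_append[of d as p "b # c # q # cs"]
    by simp
  moreover have "d p q \<le> d p b + d b q" "d b q \<le> d b c + d c q"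
    using xs assms(2) by (auto intro!: triangle)
  ultimately have "d p q = d p b + d b c + d c q"
    by simp
  then show "d (xs ! (i - 1)) (xs ! (i + 2))
      = d (xs ! (i - 1)) (xs ! i) + d (xs ! i) (xs ! (i + 1)) + d (xs ! (i + 1)) (xs ! (i + 2))"
    using xs xs' by (simp add: nth_append)
qed

text \<open>The only new adjacent pair consists of the two neighbours of the deleted point; they
  differ because their distance is a sum of two positive distances.\<close>

lemma omit_proper:
  assumes "xs \<in> proper_chains_len M d l (Suc n)" "smooth_at d xs i"
  shows "omit i xs \<in> proper_chains_len M d l n"
proof -
  obtain as p b q cs where xs: "xs = as @ p # b # q # cs" "i = Suc (length as)" "strictly_between d p b q"
    using assms(2) by (rule smooth_at_split)
  have M: "set xs \<subseteq> M" and len: "length xs = Suc (Suc n)"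
    and ne: "\<And>i. 1 \<le> i \<Longrightarrow> i \<le> Suc n \<Longrightarrow> xs ! (i - 1) \<noteq> xs ! i"
    using assms(1) by (auto simp: proper_chains_len_def proper_chains_def)
  have i: "0 < i" "Suc i < length xs"
    using assms(2) by (auto simp: smooth_at_def)
  have "d p q \<noteq> 0"
    using xs M by (auto simp: strictly_between_def) (metis add_nonneg_eq_0_iff nonneg zero)
  then have pq: "xs ! (i - 1) \<noteq> xs ! Suc i"
    using xs M by (auto simp: nth_append)
  have "omit i xs ! (j - 1) \<noteq> omit i xs ! j" if "1 \<le> j" "j \<le> n" for j
  proof (cases "j = i")
    case True
    then show ?thesis using pq i that len by (auto simp: nth_omit)
  next
    case False
    then show ?thesis
      using ne[of j] ne[of "Suc j"] that len i by (auto simp: nth_omit)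
  qed
  then show ?thesis
    using assms M len i set_omit[of i xs]
    by (auto simp: proper_chains_len_def proper_chains_def length_omit chain_length_omit)
qed

section \<open>Deletion within simple chains\<close>

lemma simple_chains_subset: "xs \<in> simple_chains M d l n \<Longrightarrow> set xs \<subseteq> M"
  by (auto simp: simple_chains_def proper_chains_len_def proper_chains_def)

lemma simple_smooth_at_omit:
  assumes "xs \<in> simple_chains M d l n" "smooth_at d xs i"
  shows "smooth_at d (omit i xs) j \<longleftrightarrow> smooth_at d xs (if j < i then j else Suc j)"
  using assms simple_chains_subset
  by (intro smooth_at_omit simple_imp_cut_free) (auto simp: simple_chains_def)

lemma simple_frame_omit:
  assumes "xs \<in> simple_chains M d l n" "smooth_at d xs i"
  shows "frame d (omit i xs) = frame d xs"
  using assms simple_chains_subset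
  by (intro frame_omit simple_imp_cut_free) (auto simp: simple_chains_def)

lemma omit_simple:
  assumes "xs \<in> simple_chains M d l (Suc n)" "smooth_at d xs i"
  shows "omit i xs \<in> simple_chains M d l n"
  using assms omit_proper[of xs l n i] simple_frame_omit[OF assms] chain_length_omit[OF assms(2)]
  by (simp add: simple_chains_def geod_simple_def)

text \<open>Smooth points can be deleted one by one without changing the frame. The process ends at
  a chain without smooth points, which is its own frame and has the same length
  \<open>l\<close>.\<close>

lemma frame_simple:
  assumes "xs \<in> simple_chains M d l n" "0 < n"
  shows "frame d xs \<in> proper_chains_upto M d l n"
  using assms
proof (induction n arbitrary: xs)
  case (Suc n)
  show ?case
  proof (cases "\<exists>i. smooth_at d xs i")
    case True
    then obtain i where i: "smooth_at d xs i" ..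
    \<comment> \<open>A smooth point is interior, so the degree is at least 2 and stays positive
      after the deletion.\<close>
    then have "n > 0"
      using Suc.prems by (auto simp: smooth_at_def simple_chains_def proper_chains_len_def proper_chains_def)
    then show ?thesis
      using Suc.IH[of "omit i xs"] omit_simple[OF Suc.prems(1) i] simple_frame_omit[OF Suc.prems(1) i]
      by (auto simp: proper_chains_upto_def)
  next
    case False
    then show ?thesis
      using Suc.prems by (auto simp: frame_no_smooth proper_chains_upto_def simple_chains_def)
  qed
qed simp

section \<open>Chains that are automatically simple\<close>

lemma cut_free_imp_simple:
  assumes "\<And>n xs. xs \<in> proper_chains_len M d l n \<Longrightarrow> cut_free d xs"
  shows "xs \<in> proper_chains_len M d l n \<Longrightarrow> geod_simple d xs"
proof (induction n arbitrary: xs)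
  case 0
  then have "length xs = 1"
    by (simp add: proper_chains_len_def proper_chains_def)
  then have "\<not> smooth_at d xs i" for i
    by (simp add: smooth_at_def)
  then show ?case by (simp add: frame_no_smooth geod_simple_def)
next
  case (Suc n)
  show ?case
  proof (cases "\<exists>i. smooth_at d xs i")
    case True
    then obtain i where i: "smooth_at d xs i" ..
    have "set xs \<subseteq> M"
      using Suc.prems by (auto simp: proper_chains_len_def proper_chains_def)
    \<comment> \<open>Deletion preserves both the frame and the length, so simplicity passes back
      from the shorter chain.\<close>
    then show ?thesis
      using Suc.IH[OF omit_proper[OF Suc.prems i]] frame_omit[of xs i] assms[OF Suc.prems] i
      by (simp add: geod_simple_def chain_length_omit)
  next
    case False
    then show ?thesis by (simp add: frame_no_smooth geod_simple_def)
  qed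
qed

text \<open>Four consecutive points form a subsequence of the chain, so their length is at most
  \<open>l\<close> and hence below the length of every 4-cut.\<close>

lemma cut_free_below_min_four_cut:
  assumes "ereal l < min_four_cut M d" "xs \<in> proper_chains_len M d l n"
  shows "cut_free d xs"
  unfolding cut_free_def
proof (intro allI impI)
  fix i assume i: "smooth_at d xs i \<and> smooth_at d xs (Suc i)"
  then obtain as p b c cs' where xs': "xs = as @ p # b # c # cs'" "i = Suc (length as)"
      "strictly_between d p b c"
    using smooth_at_split by metis
  with i obtain q cs where xs: "xs = as @ p # b # c # q # cs"
    by (cases cs') (auto simp: smooth_at_def)
  have bcq: "strictly_between d b c q"
    using i xs xs' smooth_at_append[of d "as @ [p]" b c q cs] by simp
  have M: "set xs \<subseteq> M"
    using assms(2) by (auto simp: proper_chains_len_def proper_chains_def)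
  have "chain_length d [p, b, c, q] \<le> chain_length d xs"
    using M by (intro chain_length_mono)
      (auto simp: xs list_emb_append2 intro!: list_emb_append2)
  then have "chain_length d [p, b, c, q] \<le> l"
    using assms(2) by (simp add: proper_chains_len_def)
  then have "\<not> min_four_cut M d \<le> ereal (chain_length d [p, b, c, q])"
    using assms(1) by (meson ereal_less_eq(3) leD order_trans)
  then have "[p, b, c, q] \<notin> four_cuts M d"
    unfolding min_four_cut_def by (meson INF_lower)
  moreover have "[p, b, c, q] \<in> proper_chains M 3"
    using M xs xs' bcq
    by (auto simp: proper_chains_def strictly_between_def numeral_3_eq_3 le_Suc_eq)
  \<comment> \<open>Of the conditions defining a 4-cut, only the strict inequality is left to
    fail.\<close>
  ultimately have "\<not> d p q < chain_length d [p, b, c, q]"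
    using xs' bcq by (simp add: four_cuts_def)
  moreover have "d p q \<le> d p b + d b q" "d b q \<le> d b c + d c q"
    using xs M by (auto intro!: triangle)
  ultimately have "d p q = d p b + d b c + d c q"
    by simp
  then show "d (xs ! (i - 1)) (xs ! (i + 2))
      = d (xs ! (i - 1)) (xs ! i) + d (xs ! i) (xs ! (i + 1)) + d (xs ! (i + 1)) (xs ! (i + 2))"
    using xs xs' by (simp add: nth_append)
qed

lemma simple_chains_below_min_four_cut:
  assumes "ereal l < min_four_cut M d"
  shows "simple_chains M d l = proper_chains_len M d l"
  using cut_free_imp_simple[OF cut_free_below_min_four_cut[OF assms]]
  by (auto simp: simple_chains_def)

text \<open>There is at most one interior point, so \<open>cut_free\<close> is vacuous and one
  deletion removes every smooth point. Degree 2 is included because the boundaries in degree 1 come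
  from there.\<close>

lemma simple_chains_le_2:
  assumes "n \<le> 2"
  shows "simple_chains M d l n = proper_chains_len M d l n"
proof -
  have "geod_simple d xs" if xs: "xs \<in> proper_chains_len M d l n" for xs
  proof (cases "\<exists>i. smooth_at d xs i")
    case True
    then obtain i where i: "smooth_at d xs i" ..
    have len: "length xs \<le> 3" and M: "set xs \<subseteq> M"
      using xs assms by (auto simp: proper_chains_len_def proper_chains_def)
    have "cut_free d xs"
      using len by (auto simp: cut_free_def smooth_at_def)
    moreover have "\<not> smooth_at d (omit i xs) j" for j
      using len i by (auto simp: smooth_at_def length_omit)
    ultimately show ?thesis
      using frame_omit[OF _ M i] chain_length_omit[OF i] frame_no_smooth[of d "omit i xs"]
      by (simp add: geod_simple_def)
  qed (simp add: frame_no_smooth geod_simple_def)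
  then show ?thesis by (auto simp: simple_chains_def)
qed

end

section \<open>Chain groups and their frame components\<close>

lemma boundary_0 [simp]: "boundary d n 0 = 0"
  and boundary_add: "boundary d n (a + b) = boundary d n a + boundary d n b"
  and boundary_diff: "boundary d n (a - b) = boundary d n a - boundary d n b"
  and boundary_minus: "boundary d n (- a) = - boundary d n a"
  and boundary_cmul: "boundary d n (frag_cmul k a) = frag_cmul k (boundary d n a)"
  by (simp_all add: boundary_def frag_extend_add frag_extend_diff frag_extend_minus frag_extend_cmul)

lemma boundary_sum: "finite I \<Longrightarrow> boundary d n (sum g I) = (\<Sum>i\<in>I. boundary d n (g i))"
  by (simp add: boundary_def frag_extend_sum o_def)

lemma boundary_of: "boundary d n (frag_of xs) = (\<Sum>i\<le>n. frag_cmul ((-1) ^ i) (face_map d i xs))"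
  by (simp add: boundary_def atLeast0AtMost)

lemma face_map_omit: "face_map d i xs = (if smooth_at d xs i then frag_of (omit i xs) else 0)"
  by (simp add: face_map_def omit_def)

lemma keys_boundary_of: "Poly_Mapping.keys (boundary d n (frag_of xs)) \<subseteq> {omit i xs |i. smooth_at d xs i}"
proof -
  have "Poly_Mapping.keys (boundary d n (frag_of xs))
      \<subseteq> (\<Union>i\<le>n. Poly_Mapping.keys (frag_cmul ((-1) ^ i) (face_map d i xs)))"
    unfolding boundary_of by (rule keys_sum)
  also have "\<dots> \<subseteq> {omit i xs |i. smooth_at d xs i}"
    by (auto simp: face_map_omit keys_frag_of split: if_splits)
  finally show ?thesis .
qed

lemma keys_boundary:
  "Poly_Mapping.keys (boundary d n c) \<subseteq> {omit i xs |i xs. xs \<in> Poly_Mapping.keys c \<and> smooth_at d xs i}"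
proof -
  have "Poly_Mapping.keys (boundary d n c)
      \<subseteq> (\<Union>xs\<in>Poly_Mapping.keys c. Poly_Mapping.keys (boundary d n (frag_of xs)))"
    using keys_frag_extend unfolding boundary_def by fastforce
  with keys_boundary_of[of d n] show ?thesis by blast
qed

text \<open>The projection onto the summand of frame \<open>F\<close>, defined on the whole free
  group so that no degree or length has to be carried along.\<close>

definition frame_part :: "('a \<Rightarrow> 'a \<Rightarrow> real) \<Rightarrow> 'a list \<Rightarrow> ('a list \<Rightarrow>\<^sub>0 int) \<Rightarrow> ('a list \<Rightarrow>\<^sub>0 int)" where
  "frame_part d F = frag_extend (\<lambda>xs. if frame d xs = F then frag_of xs else 0)"

lemma frame_part_0 [simp]: "frame_part d F 0 = 0"
  and frame_part_add: "frame_part d F (a + b) = frame_part d F a + frame_part d F b"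
  and frame_part_diff: "frame_part d F (a - b) = frame_part d F a - frame_part d F b"
  and frame_part_of: "frame_part d F (frag_of xs) = (if frame d xs = F then frag_of xs else 0)"
  by (simp_all add: frame_part_def frag_extend_add frag_extend_diff)

lemma frame_part_sum: "finite I \<Longrightarrow> frame_part d F (sum g I) = (\<Sum>i\<in>I. frame_part d F (g i))"
  by (simp add: frame_part_def frag_extend_sum o_def)

lemma keys_frame_part:
  "Poly_Mapping.keys (frame_part d F c) \<subseteq> {xs \<in> Poly_Mapping.keys c. frame d xs = F}"
proof -
  have "Poly_Mapping.keys (frame_part d F c)
      \<subseteq> (\<Union>xs\<in>Poly_Mapping.keys c. Poly_Mapping.keys (if frame d xs = F then frag_of xs else 0))"
    unfolding frame_part_def by (rule keys_frag_extend)
  then show ?thesis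
    by (auto simp: keys_frag_of split: if_splits)
qed

lemma frame_part_id:
  assumes "\<And>xs. xs \<in> Poly_Mapping.keys c \<Longrightarrow> frame d xs = F"
  shows "frame_part d F c = c"
proof -
  have "frame_part d F c = frag_extend frag_of c"
    unfolding frame_part_def using assms by (intro frag_extend_eq) simp
  then show ?thesis by (simp flip: frag_expansion)
qed

lemma frame_part_eq_0:
  assumes "\<And>xs. xs \<in> Poly_Mapping.keys c \<Longrightarrow> frame d xs \<noteq> F"
  shows "frame_part d F c = 0"
  unfolding frame_part_def using assms by (intro frag_extend_eq_0) simp

text \<open>Each generator survives in exactly one summand, the one of its own frame.\<close>

lemma sum_frame_part:
  assumes "finite A" "Poly_Mapping.keys c \<subseteq> {xs. frame d xs \<in> A}"
  shows "(\<Sum>F\<in>A. frame_part d F c) = c"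
  using assms(2)
proof (induction rule: frag_induction)
  case (one xs)
  then show ?case using assms(1) by (simp add: frame_part_of)
next
  case (diff a b)
  then show ?case by (simp add: frame_part_diff sum_subtractf)
qed simp

section \<open>Homology\<close>

definition cycle_group ::
  "('a \<Rightarrow> 'a \<Rightarrow> real) \<Rightarrow> (nat \<Rightarrow> 'a list set) \<Rightarrow> nat \<Rightarrow> ('a list \<Rightarrow>\<^sub>0 int) monoid" where
  "cycle_group d C n = subgroup_generated (free_Abelian_group (C n))
     {c \<in> carrier (free_Abelian_group (C n)). boundary d n c = 0}"

definition boundaries ::
  "('a \<Rightarrow> 'a \<Rightarrow> real) \<Rightarrow> (nat \<Rightarrow> 'a list set) \<Rightarrow> nat \<Rightarrow> ('a list \<Rightarrow>\<^sub>0 int) set" where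
  "boundaries d C n = boundary d (n + 1) ` carrier (free_Abelian_group (C (n + 1)))"

lemma chain_homology_eq: "chain_homology d C n = cycle_group d C n Mod boundaries d C n"
  by (simp add: chain_homology_def cycle_group_def boundaries_def)

text \<open>The cycles already form a subgroup, so passing to the generated subgroup adds
  nothing.\<close>

lemma carrier_cycle_group:
  "carrier (cycle_group d C n) = {c. Poly_Mapping.keys c \<subseteq> C n \<and> boundary d n c = 0}"
proof -
  interpret group "free_Abelian_group (C n)" by simp
  have "subgroup {c \<in> carrier (free_Abelian_group (C n)). boundary d n c = 0} (free_Abelian_group (C n))"
  proof (rule subgroupI)
    show "{c \<in> carrier (free_Abelian_group (C n)). boundary d n c = 0} \<noteq> {}"
      by (auto intro!: exI[of _ 0])
  qed (auto simp: boundary_minus boundary_add keys_minus dest: subsetD[OF keys_add])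
  then show ?thesis
    unfolding cycle_group_def
    by (subst subgroup.carrier_subgroup_generated_subgroup) auto
qed

lemma mult_cycle_group [simp]: "x \<otimes>\<^bsub>cycle_group d C n\<^esub> y = x + y"
  and one_cycle_group [simp]: "\<one>\<^bsub>cycle_group d C n\<^esub> = 0"
  by (simp_all add: cycle_group_def)

lemma comm_group_cycle_group: "comm_group (cycle_group d C n)"
  unfolding cycle_group_def
  by (intro group.abelian_subgroup_generated abelian_free_Abelian_group) simp

lemma mem_boundaries: "x \<in> boundaries d C n \<longleftrightarrow> (\<exists>b. Poly_Mapping.keys b \<subseteq> C (Suc n) \<and> x = boundary d (Suc n) b)"
  by (simp add: boundaries_def image_iff Bex_def)

lemma zero_mem_boundaries: "0 \<in> boundaries d C n"
  unfolding mem_boundaries by (intro exI[of _ 0]) simp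

text \<open>Stated for a general family \<open>C\<close>, to serve both the simple complex and each
  frame complex. The assumptions say on generators that faces stay in the family and that the
  boundary squares to zero; normality then comes from commutativity.\<close>

lemma normal_boundaries:
  assumes "\<And>xs i. \<lbrakk>xs \<in> C (Suc n); smooth_at d xs i\<rbrakk> \<Longrightarrow> omit i xs \<in> C n"
    and "\<And>xs. xs \<in> C (Suc n) \<Longrightarrow> boundary d n (boundary d (Suc n) (frag_of xs)) = 0"
  shows "boundaries d C n \<lhd> cycle_group d C n"
proof -
  interpret comm_group "cycle_group d C n" by (rule comm_group_cycle_group)
  have bb: "boundary d n (boundary d (Suc n) b) = 0" if "Poly_Mapping.keys b \<subseteq> C (Suc n)" for b
    using that by (induction rule: frag_induction) (auto simp: boundary_diff assms(2))
  have sub: "boundaries d C n \<subseteq> carrier (cycle_group d C n)"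
    using keys_boundary assms(1) by (fastforce simp: mem_boundaries carrier_cycle_group bb)
  have "subgroup (boundaries d C n) (cycle_group d C n)"
  proof (rule subgroupI)
    show "boundaries d C n \<noteq> {}"
      using zero_mem_boundaries by blast
  next
    fix a assume a: "a \<in> boundaries d C n"
    then obtain b where b: "Poly_Mapping.keys b \<subseteq> C (Suc n)" "a = boundary d (Suc n) b"
      by (auto simp: mem_boundaries)
    have ma: "- a \<in> boundaries d C n"
      unfolding mem_boundaries using b by (intro exI[of _ "- b"]) (simp add: boundary_minus keys_minus)
    have "inv\<^bsub>cycle_group d C n\<^esub> a = - a"
      using a ma sub by (intro inv_equality) auto
    with ma show "inv\<^bsub>cycle_group d C n\<^esub> a \<in> boundaries d C n" by simp
  next
    fix a b assume "a \<in> boundaries d C n" "b \<in> boundaries d C n"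
    then obtain a' b' where "Poly_Mapping.keys a' \<subseteq> C (Suc n)" "a = boundary d (Suc n) a'"
        "Poly_Mapping.keys b' \<subseteq> C (Suc n)" "b = boundary d (Suc n) b'"
      by (auto simp: mem_boundaries)
    then have "Poly_Mapping.keys (a' + b') \<subseteq> C (Suc n) \<and> a + b = boundary d (Suc n) (a' + b')"
      by (auto simp: boundary_add dest: subsetD[OF keys_add])
    then show "a \<otimes>\<^bsub>cycle_group d C n\<^esub> b \<in> boundaries d C n"
      by (auto simp: mem_boundaries)
  qed (rule sub)
  then show ?thesis by (rule subgroup_imp_normal)
qed

section \<open>Splitting simple homology by frames\<close>

context Metric_space
begin

text \<open>The usual simplicial cancellation. Since vanishing faces depend on smoothness, it also
  needs \<open>simple_smooth_at_omit\<close>: whether both deletions are allowed does not depend on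
  their order.\<close>

lemma boundary_boundary_simple:
  assumes xs: "xs \<in> simple_chains M d l (Suc n)"
  shows "boundary d n (boundary d (Suc n) (frag_of xs)) = 0"
proof -
  \<comment> \<open>The signed contribution of deleting index \<open>i\<close> first and then index
    \<open>j\<close> of the shorter chain.\<close>
  define t where "t i j = frag_cmul ((-1) ^ (i + j))
     (if smooth_at d xs i \<and> smooth_at d (omit i xs) j then frag_of (omit j (omit i xs)) else 0)" for i j
  have *: "boundary d n (frag_cmul ((-1) ^ i) (face_map d i xs)) = (\<Sum>j\<le>n. t i j)" for i
    by (auto simp: boundary_cmul boundary_of frag_cmul_sum face_map_omit t_def power_add
        intro!: sum.cong)
  have "boundary d n (boundary d (Suc n) (frag_of xs)) = (\<Sum>i\<le>Suc n. \<Sum>j\<le>n. t i j)"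
    by (subst boundary_of) (simp only: boundary_sum finite_atMost *)
  also have "\<dots> = (\<Sum>(i,j)\<in>{..Suc n} \<times> {..n}. t i j)"
    by (simp only: sum.cartesian_product)
  also have "{..Suc n} \<times> {..n} = {(i,j). i \<le> j \<and> j \<le> n} \<union> {(i,j). j < i \<and> i \<le> Suc n}"
    by auto
  also have "sum (\<lambda>(i,j). t i j) \<dots> = (\<Sum>(i,j)\<in>{(i,j). i \<le> j \<and> j \<le> n}. t i j) + (\<Sum>(i,j)\<in>{(i,j). j < i \<and> i \<le> Suc n}. t i j)"
    by (rule sum.union_disjoint) (auto intro: finite_subset[of _ "{..Suc n} \<times> {..Suc n}"])
  \<comment> \<open>The deletion \<open>(i, j)\<close> with \<open>j < i\<close> is matched with the
    same two deletions in the other order, \<open>(j, i - 1)\<close>.\<close>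
  also have "(\<Sum>(i,j)\<in>{(i,j). j < i \<and> i \<le> Suc n}. t i j) = (\<Sum>(i,j)\<in>{(i,j). i \<le> j \<and> j \<le> n}. t (Suc j) i)"
    by (rule sum.reindex_bij_witness[of _ "\<lambda>(i,j). (Suc j, i)" "\<lambda>(i,j). (j, i - 1)"]) auto
  also have "\<dots> = (\<Sum>(i,j)\<in>{(i,j). i \<le> j \<and> j \<le> n}. - t i j)"
  proof (intro sum.cong refl, clarify)
    fix i j :: nat assume ij: "i \<le> j" "j \<le> n"
    have len: "length xs = Suc (Suc n)"
      using xs by (simp add: simple_chains_def proper_chains_len_def proper_chains_def)
    \<comment> \<open>Both sides say that the original points at \<open>i\<close> and
      \<open>Suc j\<close> are smooth.\<close>
    have "smooth_at d xs (Suc j) \<and> smooth_at d (omit (Suc j) xs) i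
        \<longleftrightarrow> smooth_at d xs i \<and> smooth_at d (omit i xs) j"
      using ij simple_smooth_at_omit[OF xs] by auto
    moreover have "omit i (omit (Suc j) xs) = omit j (omit i xs)"
      using ij len by (subst omit_omit) auto
    ultimately show "t (Suc j) i = - t i j"
      by (simp add: t_def add.commute)
  qed
  finally show ?thesis
    by (simp add: sum_negf case_prod_unfold)
qed

text \<open>Membership fixes the length of \<open>F\<close> as \<open>l\<close>, so a chain of
  length \<open>l\<close> with frame \<open>F\<close> is simple. The degree \<open>k\<close> is free
  because degree \<open>n + 1\<close> is needed for boundaries.\<close>

lemma frame_chains_eq:
  assumes "F \<in> proper_chains_upto M d l n"
  shows "frame_chains M d F k = {xs \<in> simple_chains M d l k. frame d xs = F}"
  using assms by (auto simp: frame_chains_def simple_chains_def geod_simple_def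
      proper_chains_upto_def proper_chains_len_def)

text \<open>The projections are chain maps: all faces of a simple chain have its frame, so they are
  kept or killed together with it.\<close>

lemma boundary_frame_part:
  assumes "Poly_Mapping.keys c \<subseteq> simple_chains M d l n"
  shows "boundary d n (frame_part d F c) = frame_part d F (boundary d n c)"
  using assms
proof (induction rule: frag_induction)
  case (one xs)
  have "frame d ys = frame d xs" if "ys \<in> Poly_Mapping.keys (boundary d n (frag_of xs))" for ys
    using keys_boundary_of that simple_frame_omit[OF one] by fastforce
  then show ?case
    by (cases "frame d xs = F") (auto simp: frame_part_of frame_part_id frame_part_eq_0)
qed (simp_all add: boundary_diff frame_part_diff)

text \<open>First isomorphism theorem for the map \<open>h\<close> from cycles to families of
  homology classes: it is onto, and its kernel consists of the boundaries.\<close>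

lemma simple_homology_iso:
  assumes n: "n > 0"
  shows "simple_homology M d l n
    \<cong> sum_group (proper_chains_upto M d l n) (\<lambda>F. frame_homology M d F n)"
proof -
  let ?I = "proper_chains_upto M d l n"
  let ?S = "simple_chains M d l"
  let ?Z = "cycle_group d ?S n" and ?B = "boundaries d ?S n"
  let ?ZF = "\<lambda>F. cycle_group d (frame_chains M d F) n" and ?BF = "\<lambda>F. boundaries d (frame_chains M d F) n"
  let ?H = "sum_group ?I (\<lambda>F. frame_homology M d F n)"
  \<comment> \<open>Restricted to \<open>?I\<close> because the elements of \<open>sum_group\<close>
    are extensional functions.\<close>
  define h where "h c = (\<lambda>F\<in>?I. ?BF F #>\<^bsub>?ZF F\<^esub> frame_part d F c)" for c
  have H_eq: "frame_homology M d F n = ?ZF F Mod ?BF F" for F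
    by (simp add: frame_homology_def chain_homology_eq)
  have normal: "?BF F \<lhd> ?ZF F" if F: "F \<in> ?I" for F
  proof (rule normal_boundaries)
    fix xs i assume "xs \<in> frame_chains M d F (Suc n)" "smooth_at d xs i"
    then show "omit i xs \<in> frame_chains M d F n"
      using omit_simple[of xs l n i] simple_frame_omit[of xs l "Suc n" i] by (auto simp: frame_chains_eq[OF F])
  next
    fix xs assume "xs \<in> frame_chains M d F (Suc n)"
    then show "boundary d n (boundary d (Suc n) (frag_of xs)) = 0"
      by (auto simp: frame_chains_eq[OF F] intro: boundary_boundary_simple)
  qed
  have group_ZF: "group (?ZF F)" for F
    using comm_group_cycle_group by (rule comm_group.axioms)
  have group_H: "group (frame_homology M d F n)" if "F \<in> ?I" for F
    unfolding H_eq using normal[OF that] by (rule normal.factorgroup_is_group)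
  have one_H: "\<one>\<^bsub>frame_homology M d F n\<^esub> = ?BF F" for F
    by (simp add: H_eq)
  have carrier_H: "carrier ?H =
      {y \<in> \<Pi>\<^sub>E F\<in>?I. carrier (frame_homology M d F n). finite {F \<in> ?I. y F \<noteq> ?BF F}}"
    by (simp add: carrier_sum_group group_H one_H)
  have part_Z: "frame_part d F c \<in> carrier (?ZF F)" if "c \<in> carrier ?Z" "F \<in> ?I" for c F
    using that keys_frame_part[of d F c]
    by (auto simp: carrier_cycle_group frame_chains_eq[OF that(2)] boundary_frame_part)
  have coset_eq: "?BF F #>\<^bsub>?ZF F\<^esub> z = ?BF F \<longleftrightarrow> z \<in> ?BF F" if "F \<in> ?I" "z \<in> carrier (?ZF F)" for F z
    using group.coset_join1[OF group_ZF _ that(2)] group.coset_join2[OF group_ZF that(2)]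
      normal_imp_subgroup[OF normal[OF that(1)]] by metis
  have h_closed: "h c \<in> carrier ?H" if c: "c \<in> carrier ?Z" for c
  proof -
    \<comment> \<open>Only the finitely many frames occurring in \<open>c\<close> can give a
      nontrivial class.\<close>
    have "{F \<in> ?I. h c F \<noteq> ?BF F} \<subseteq> frame d ` Poly_Mapping.keys c"
    proof clarify
      fix F assume F: "F \<in> ?I" "h c F \<noteq> ?BF F"
      then have "frame_part d F c \<noteq> 0"
        using coset_eq[OF F(1) part_Z[OF c F(1)]] by (auto simp: h_def zero_mem_boundaries)
      then show "F \<in> frame d ` Poly_Mapping.keys c"
        using frame_part_eq_0[of c d F] by auto
    qed
    then have "finite {F \<in> ?I. h c F \<noteq> ?BF F}"
      by (rule finite_subset) simp
    moreover have "h c \<in> (\<Pi>\<^sub>E F\<in>?I. carrier (frame_homology M d F n))"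
      using part_Z[OF c] by (auto simp: h_def H_eq carrier_FactGroup)
    ultimately show ?thesis
      by (simp add: carrier_H)
  qed
  have "group_hom ?Z ?H h"
  proof (intro group_hom.intro group_hom_axioms.intro homI)
    show "group ?Z"
      using comm_group_cycle_group by (rule comm_group.axioms)
    show "group ?H"
      using group_H by simp
  next
    fix a b assume ab: "a \<in> carrier ?Z" "b \<in> carrier ?Z"
    show "h (a \<otimes>\<^bsub>?Z\<^esub> b) = h a \<otimes>\<^bsub>?H\<^esub> h b"
    proof (rule ext)
      fix F
      show "h (a \<otimes>\<^bsub>?Z\<^esub> b) F = (h a \<otimes>\<^bsub>?H\<^esub> h b) F"
      proof (cases "F \<in> ?I")
        case True
        then show ?thesis
          using normal.rcos_sum[OF normal[OF True] part_Z[OF ab(1) True] part_Z[OF ab(2) True]]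
          by (simp add: h_def H_eq frame_part_add)
      qed (simp add: h_def)
    qed
  qed (rule h_closed)
  moreover have "h ` carrier ?Z = carrier ?H"
  proof
    show "carrier ?H \<subseteq> h ` carrier ?Z"
    proof
      fix y assume "y \<in> carrier ?H"
      then have y: "\<And>F. F \<in> ?I \<Longrightarrow> \<exists>z\<in>carrier (?ZF F). y F = ?BF F #>\<^bsub>?ZF F\<^esub> z"
          "y \<in> extensional ?I" "finite {F \<in> ?I. y F \<noteq> ?BF F}"
        unfolding carrier_H
        by (auto simp: H_eq carrier_FactGroup PiE_iff)
      then obtain z where z: "\<And>F. F \<in> ?I \<Longrightarrow> z F \<in> carrier (?ZF F)"
          "\<And>F. F \<in> ?I \<Longrightarrow> y F = ?BF F #>\<^bsub>?ZF F\<^esub> z F"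
        by metis
      define A where "A = {F \<in> ?I. y F \<noteq> ?BF F}"
      have A: "finite A" "A \<subseteq> ?I"
        using y(3) by (auto simp: A_def)
      have keys_z: "Poly_Mapping.keys (z F) \<subseteq> {xs \<in> ?S n. frame d xs = F}" if "F \<in> ?I" for F
        using z(1)[OF that] by (auto simp: carrier_cycle_group frame_chains_eq[OF that])
      \<comment> \<open>A preimage of \<open>y\<close>: the sum of representatives over the finite
        support of \<open>y\<close>.\<close>
      define c where "c = sum z A"
      have "Poly_Mapping.keys c \<subseteq> ?S n"
        unfolding c_def using keys_z A by (intro order_trans[OF keys_sum]) blast
      moreover have "boundary d n c = 0"
        unfolding c_def using A z(1) by (auto simp: boundary_sum carrier_cycle_group intro!: sum.neutral)
      ultimately have c: "c \<in> carrier ?Z"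
        by (simp add: carrier_cycle_group)
      have part_c: "frame_part d F c = (if F \<in> A then z F else 0)" for F
      proof -
        have "frame_part d F (z G) = (if G = F then z G else 0)" if "G \<in> A" for G
          using keys_z[of G] that A by (auto intro!: frame_part_id frame_part_eq_0)
        then show ?thesis
          using A by (simp add: c_def frame_part_sum)
      qed
      have "h c F = y F" for F
      proof (cases "F \<in> ?I")
        case True
        show ?thesis
        proof (cases "F \<in> A")
          case False
          then have "y F = ?BF F" using True by (simp add: A_def)
          \<comment> \<open>Off the support, the class of the part \<open>0\<close> is the neutral
            coset.\<close>
          moreover have "?BF F #>\<^bsub>?ZF F\<^esub> 0 = ?BF F"
            using part_Z[OF c True] False by (simp add: part_c coset_eq[OF True] zero_mem_boundaries)
          ultimately show ?thesis using True False by (simp add: h_def part_c)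
        qed (use True z in \<open>simp add: h_def part_c\<close>)
      qed (use y(2) in \<open>simp add: h_def extensional_def\<close>)
      then show "y \<in> h ` carrier ?Z"
        using c by (metis (no_types, lifting) ext image_eqI)
    qed
  qed (use h_closed in blast)
  ultimately have iso: "?Z Mod kernel ?Z ?H h \<cong> ?H"
    by (rule group_hom.FactGroup_iso)
  have h_one: "h c = \<one>\<^bsub>?H\<^esub> \<longleftrightarrow> (\<forall>F\<in>?I. frame_part d F c \<in> ?BF F)" if "c \<in> carrier ?Z" for c
  proof -
    have "h c = \<one>\<^bsub>?H\<^esub> \<longleftrightarrow> (\<forall>F\<in>?I. ?BF F #>\<^bsub>?ZF F\<^esub> frame_part d F c = ?BF F)"
      by (auto simp: h_def H_eq restrict_def fun_eq_iff)
    also have "\<dots> \<longleftrightarrow> (\<forall>F\<in>?I. frame_part d F c \<in> ?BF F)"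
      using coset_eq part_Z[OF that] by simp
    finally show ?thesis .
  qed
  have "kernel ?Z ?H h = ?B"
  proof (intro subset_antisym subsetI)
    fix c assume "c \<in> kernel ?Z ?H h"
    then have c: "c \<in> carrier ?Z" "\<And>F. F \<in> ?I \<Longrightarrow> frame_part d F c \<in> ?BF F"
      using h_one by (auto simp: kernel_def)
    then obtain b where b: "\<And>F. F \<in> ?I \<Longrightarrow> Poly_Mapping.keys (b F) \<subseteq> frame_chains M d F (Suc n)"
        "\<And>F. F \<in> ?I \<Longrightarrow> frame_part d F c = boundary d (Suc n) (b F)"
      unfolding mem_boundaries by metis
    \<comment> \<open>Only frames occurring in \<open>c\<close> need a bounding chain
      \<open>b F\<close>; \<open>frame_simple\<close> places them all in \<open>?I\<close>.\<close>
    define A where "A = frame d ` Poly_Mapping.keys c"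
    have A: "finite A" "A \<subseteq> ?I"
      using c(1) frame_simple[OF _ n] by (auto simp: A_def carrier_cycle_group)
    have "c = (\<Sum>F\<in>A. frame_part d F c)"
      using A(1) by (intro sum_frame_part[symmetric]) (auto simp: A_def)
    also have "\<dots> = boundary d (Suc n) (sum b A)"
      using A b(2) by (auto simp: boundary_sum intro!: sum.cong)
    finally have "c = boundary d (Suc n) (sum b A)" .
    moreover have "Poly_Mapping.keys (sum b A) \<subseteq> ?S (Suc n)"
      using b(1) A(2) frame_chains_eq by (intro order_trans[OF keys_sum]) blast
    ultimately show "c \<in> ?B"
      by (auto simp: mem_boundaries)
  next
    fix c assume "c \<in> ?B"
    then obtain b where b: "Poly_Mapping.keys b \<subseteq> ?S (Suc n)" "c = boundary d (Suc n) b"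
      by (auto simp: mem_boundaries)
    have "?B \<lhd> ?Z"
      using omit_simple boundary_boundary_simple by (rule normal_boundaries)
    then have c: "c \<in> carrier ?Z"
      using \<open>c \<in> ?B\<close> normal_imp_subgroup subgroup.subset by blast
    \<comment> \<open>Projecting the bounding chain \<open>b\<close> gives a bounding chain for the
      projection of \<open>c\<close>.\<close>
    have "frame_part d F c \<in> ?BF F" if "F \<in> ?I" for F
      unfolding mem_boundaries using b keys_frame_part[of d F b]
      by (intro exI[of _ "frame_part d F b"]) (auto simp: frame_chains_eq[OF that] boundary_frame_part)
    then show "c \<in> kernel ?Z ?H h"
      using c h_one by (simp add: kernel_def)
  qed
  with iso show ?thesis
    by (simp add: simple_homology_def chain_homology_eq)
qed

end

theorem theorem3p12:
  fixes M :: "'a set" and d :: "'a \<Rightarrow> 'a \<Rightarrow> real" and n :: nat and l :: real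
  assumes "Metric_space M d" and "n > 0" and "l > 0"
  shows "simple_homology M d l n
           \<cong> sum_group (proper_chains_upto M d l n) (\<lambda>F. frame_homology M d F n)
       \<and> (n = 1 \<longrightarrow>
           magnitude_homology M d l 1
             \<cong> sum_group (proper_chains_len M d l 1) (\<lambda>F. frame_homology M d F 1))
       \<and> (ereal l < min_four_cut M d \<longrightarrow>
           magnitude_homology M d l n
             \<cong> sum_group (proper_chains_upto M d l n) (\<lambda>F. frame_homology M d F n))"
proof -
  interpret Metric_space M d by fact
  \<comment> \<open>Only chains of degrees 1 and 2 enter, and these are all simple.\<close>
  have "magnitude_homology M d l 1 = simple_homology M d l 1"
    by (simp add: magnitude_homology_def simple_homology_def chain_homology_def simple_chains_le_2)
  moreover have "proper_chains_upto M d l 1 = proper_chains_len M d l 1"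
    by (simp add: proper_chains_upto_def)
  moreover have "magnitude_homology M d l n = simple_homology M d l n" if "ereal l < min_four_cut M d"
    by (simp add: magnitude_homology_def simple_homology_def simple_chains_below_min_four_cut[OF that])
  ultimately show ?thesis
    using simple_homology_iso[OF \<open>n > 0\<close>, of l] simple_homology_iso[of 1 l] by auto
qed

end
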